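(* Let $P$ be an HCP process and let $\mathcal{G}$, $\mathcal{G}'$ be hyperenvironments. If $\vdash P :: \mathcal{G}$ is derivable, $P \Vdash \mathrm{strip}(\mathcal{G}')$ is derivable, and $\mathcal{G}$ and $\mathcal{G}'$ are shufflings of each other, then $\vdash P :: \mathcal{G}'$ is derivable.
   Context: HCP processes (names $x,y,z,\dots$) are generated by: $x[y].P$ (output, binds $y$ in $P$), $x(y).P$ (input, binds $y$), $x[].P$, $x().P$, $x[\mathsf{inl}].P$, $x[\mathsf{inr}].P$, $x.\mathsf{case}(P,Q)$, $!x(y).P$ (binds $y$), $?x[y].P$ (binds $y$), $?x[x_1,x_2].P$ (binds $x_1,x_2$), $?x[].P$, $(\nu xy)P$ (binds $x,y$), $P \mid Q$, $\mathbf{0}$, $[x\leftrightarrow y]$; processes are considered up to $\alpha$-conversion. Types: $A,B ::= A\otimes B \mid A \mathbin{⅋} B \mid A\oplus B \mid A \,\&\, B \mid 1 \mid \bot \mid ?A \mid !A$, with the involutive duality $A^\perp$ given by $(A\otimes B)^\perp = A^\perp ⅋ B^\perp$, $(A\oplus B)^\perp = A^\perp \& B^\perp$, $1^\perp=\bot$, $(?A)^\perp = !A^\perp$ and symmetrically. An environment $\Gamma$ is an unordered finite list $x_1:A_1,\dots,x_n:A_n$ of distinct names with types ($\bullet$ empty); $\Gamma,\Delta$ presupposes disjoint names. A hyperenvironment $\mathcal{G} = \Gamma_1 \mid \cdots \mid \Gamma_n$ is an unordered collection of environments with all names distinct ($\varnothing$ empty); $\mathcal{G}\mid\mathcal{H}$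 presupposes disjoint names. $?\Gamma$ denotes an environment all of whose types have the form $?B$. Typing judgements $\vdash P :: \mathcal{G}$ are derived by the rules: (Ax) $\vdash [x\leftrightarrow y] :: x:A^\perp, y:A$; (H-Cut) from $\vdash P :: \mathcal{G}\mid \Gamma,x:A \mid \Delta, y:A^\perp$ infer $\vdash (\nu xy)P :: \mathcal{G}\mid\Gamma,\Delta$; (H-Mix) from $\vdash P::\mathcal{G}$ and $\vdash Q::\mathcal{H}$ infer $\vdash P\mid Q :: \mathcal{G}\mid\mathcal{H}$; (H-Mix$_0$) $\vdash \mathbf{0}::\varnothing$; ($\otimes$) from $\vdash P :: \mathcal{G}\mid\Gamma,y:A\mid\Delta,x:B$ infer $\vdash x[y].P :: \mathcal{G}\mid\Gamma,\Delta,x:A\otimes B$; ($1$) from $\vdash P::\mathcal{G}$ infer $\vdash x[].P :: \mathcal{G}\mid x:1$; (⅋) from $\vdash P :: \mathcal{G}\mid\Gamma,y:A,x:B$ infer $\vdash x(y).P :: \mathcal{G}\mid\Gamma, x:A⅋B$; ($\bot$) from $\vdash P::\mathcal{G}\mid\Gamma$ infer $\vdash x().P :: \mathcal{G}\mid\Gamma,x:\bot$; ($\oplus_1$) from $\vdash P::\mathcal{G}\mid\Gamma,x:A$ infer $\vdash x[\mathsf{inl}].P :: \mathcal{G}\mid\Gamma,x:A\oplus B$; ($\oplus_2$) from $\vdash P::\mathcal{G}\mid\Gamma,x:B$ infer $\vdash x[\mathsf{inr}].P :: \mathcal{G}\mid\Gamma,x:A\oplus B$; ($\&$) from $\vdash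 P::\Gamma,x:A$ and $\vdash Q::\Gamma,x:B$ infer $\vdash x.\mathsf{case}(P,Q)::\Gamma,x:A\&B$; ($!$) from $\vdash P :: ?\Gamma, y:A$ infer $\vdash !x(y).P :: ?\Gamma, x:!A$; ($?$) from $\vdash P::\mathcal{G}\mid\Gamma,y:A$ infer $\vdash ?x[y].P :: \mathcal{G}\mid\Gamma,x:?A$; (W) from $\vdash P::\mathcal{G}\mid\Gamma$ infer $\vdash ?x[].P::\mathcal{G}\mid\Gamma,x:?A$; (C) from $\vdash P::\mathcal{G}\mid\Gamma,x':?A,x'':?A$ infer $\vdash ?x[x',x''].P::\mathcal{G}\mid\Gamma,x:?A$. Partition judgements $P \Vdash G$, where $G$ is a hyperenvironment of bare names (no types), are derived by the same rules with all types and type constraints erased and $\vdash$ replaced by $\Vdash$. $\mathrm{strip}(\mathcal{G})$ is the name partition obtained by erasing types from $\mathcal{G}$. Two hyperenvironments $\mathcal{G},\mathcal{G}'$ are shufflings of each other if they contain the same number of non-empty environments and, for all $x$ and $A$, $x:A$ occurs in $\mathcal{G}$ iff $x:A$ occurs in $\mathcal{G}'$. *)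

theory Defs
  imports "HOL-Library.Multiset" "HOL-Combinatorics.Transposition"
begin

type_synonym name = nat

datatype ty =
    Tensor ty ty
  | Parr ty ty
  | Plus ty ty
  | With ty ty
  | One
  | Bot
  | WhyNot ty
  | OfCourse ty

primrec dual :: "ty \<Rightarrow> ty" where
  "dual (Tensor A B) = Parr (dual A) (dual B)"
| "dual (Parr A B) = Tensor (dual A) (dual B)"
| "dual (Plus A B) = With (dual A) (dual B)"
| "dual (With A B) = Plus (dual A) (dual B)"
| "dual One = Bot"
| "dual Bot = One"
| "dual (WhyNot A) = OfCourse (dual A)"
| "dual (OfCourse A) = WhyNot (dual A)"


(* \<open>names\<close> collects all names occurring in a raw process, binding occurrences
   included, and \<open>rename f\<close> applies f to all of them, binding occurrences included. *)
datatype (names: 'n) raw_process =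
    ROut 'n 'n "'n raw_process"          (* x[y].P, binds y *)
  | RInp 'n 'n "'n raw_process"          (* x(y).P, binds y *)
  | RClose 'n "'n raw_process"           (* x[].P *)
  | RWait 'n "'n raw_process"            (* x().P *)
  | RSelL 'n "'n raw_process"            (* x[inl].P *)
  | RSelR 'n "'n raw_process"            (* x[inr].P *)
  | RCase 'n "'n raw_process" "'n raw_process"  (* x.case(P,Q) *)
  | RServer 'n 'n "'n raw_process"       (* !x(y).P, binds y *)
  | RClient 'n 'n "'n raw_process"       (* ?x[y].P, binds y *)
  | RDup 'n 'n 'n "'n raw_process"       (* ?x[x1,x2].P, binds x1, x2 *)
  | RDisp 'n "'n raw_process"            (* ?x[].P *)
  | RRes 'n 'n "'n raw_process"          (* (nu x y)P, binds x, y *)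
  | RPar "'n raw_process" "'n raw_process"      (* P | Q *)
  | RNil                                 (* 0 *)
  | RLink 'n 'n                          (* [x <-> y] *)
for map: rename

(* Alpha-equivalence: the bound names of both sides are replaced by common names that
   do not occur at all on either side, so that replacing every occurrence is capture-free.
   In a simultaneous binder that repeats a name the second position shadows the first;
   such a binder is equivalent to one with distinct names. *)
inductive alpha :: "name raw_process \<Rightarrow> name raw_process \<Rightarrow> bool" where
  alpha_Out: "z \<notin> names P \<union> names P' \<Longrightarrow>
    alpha (rename (id(y := z)) P) (rename (id(y' := z)) P') \<Longrightarrow>
    alpha (ROut x y P) (ROut x y' P')"
| alpha_Inp: "z \<notin> names P \<union> names P' \<Longrightarrow>
    alpha (rename (id(y := z)) P) (rename (id(y' := z)) P') \<Longrightarrow>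
    alpha (RInp x y P) (RInp x y' P')"
| alpha_Close: "alpha P P' \<Longrightarrow> alpha (RClose x P) (RClose x P')"
| alpha_Wait: "alpha P P' \<Longrightarrow> alpha (RWait x P) (RWait x P')"
| alpha_SelL: "alpha P P' \<Longrightarrow> alpha (RSelL x P) (RSelL x P')"
| alpha_SelR: "alpha P P' \<Longrightarrow> alpha (RSelR x P) (RSelR x P')"
| alpha_Case: "alpha P P' \<Longrightarrow> alpha Q Q' \<Longrightarrow> alpha (RCase x P Q) (RCase x P' Q')"
| alpha_Server: "z \<notin> names P \<union> names P' \<Longrightarrow>
    alpha (rename (id(y := z)) P) (rename (id(y' := z)) P') \<Longrightarrow>
    alpha (RServer x y P) (RServer x y' P')"
| alpha_Client: "z \<notin> names P \<union> names P' \<Longrightarrow>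
    alpha (rename (id(y := z)) P) (rename (id(y' := z)) P') \<Longrightarrow>
    alpha (RClient x y P) (RClient x y' P')"
| alpha_Dup: "z1 \<noteq> z2 \<Longrightarrow> z1 \<notin> names P \<union> names P' \<Longrightarrow> z2 \<notin> names P \<union> names P' \<Longrightarrow>
    alpha (rename (id(y1 := z1, y2 := z2)) P) (rename (id(y1' := z1, y2' := z2)) P') \<Longrightarrow>
    alpha (RDup x y1 y2 P) (RDup x y1' y2' P')"
| alpha_Disp: "alpha P P' \<Longrightarrow> alpha (RDisp x P) (RDisp x P')"
| alpha_Res: "z1 \<noteq> z2 \<Longrightarrow> z1 \<notin> names P \<union> names P' \<Longrightarrow> z2 \<notin> names P \<union> names P' \<Longrightarrow>
    alpha (rename (id(y1 := z1, y2 := z2)) P) (rename (id(y1' := z1, y2' := z2)) P') \<Longrightarrow>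
    alpha (RRes y1 y2 P) (RRes y1' y2' P')"
| alpha_Par: "alpha P P' \<Longrightarrow> alpha Q Q' \<Longrightarrow> alpha (RPar P Q) (RPar P' Q')"
| alpha_Nil: "alpha RNil RNil"
| alpha_Link: "alpha (RLink x y) (RLink x y)"

lemma finite_names: "finite (names P)"
  by (induction P) auto

lemma rename_update1:
  assumes "inj f"
  shows "rename f (rename (id(y := z)) P) = rename (id(f y := f z)) (rename f P)"
  using assms by (auto simp: raw_process.map_comp inj_eq intro!: raw_process.map_cong0)

lemma rename_update2:
  assumes "inj f"
  shows "rename f (rename (id(y1 := z1, y2 := z2)) P)
       = rename (id(f y1 := f z1, f y2 := f z2)) (rename f P)"
  using assms by (auto simp: raw_process.map_comp inj_eq intro!: raw_process.map_cong0)

lemma alpha_rename: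
  assumes "alpha P Q" "inj f"
  shows "alpha (rename f P) (rename f Q)"
  using assms(1)
proof (induction rule: alpha.induct)
  case (alpha_Out z P P' y y' x)
  then show ?case
    using alpha.alpha_Out[of "f z" "rename f P" "rename f P'" "f y" "f y'" "f x"] assms(2)
    by (auto simp: rename_update1 raw_process.set_map inj_eq inj_image_mem_iff)
next
  case (alpha_Inp z P P' y y' x)
  then show ?case
    using alpha.alpha_Inp[of "f z" "rename f P" "rename f P'" "f y" "f y'" "f x"] assms(2)
    by (auto simp: rename_update1 raw_process.set_map inj_eq inj_image_mem_iff)
next
  case (alpha_Server z P P' y y' x)
  then show ?case
    using alpha.alpha_Server[of "f z" "rename f P" "rename f P'" "f y" "f y'" "f x"] assms(2)
    by (auto simp: rename_update1 raw_process.set_map inj_eq inj_image_mem_iff)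
next
  case (alpha_Client z P P' y y' x)
  then show ?case
    using alpha.alpha_Client[of "f z" "rename f P" "rename f P'" "f y" "f y'" "f x"] assms(2)
    by (auto simp: rename_update1 raw_process.set_map inj_eq inj_image_mem_iff)
next
  case (alpha_Dup z1 z2 P P' y1 y2 y1' y2' x)
  then show ?case
    using alpha.alpha_Dup[of "f z1" "f z2" "rename f P" "rename f P'" "f y1" "f y2" "f y1'" "f y2'" "f x"]
      assms(2)
    by (auto simp: rename_update2 raw_process.set_map inj_eq inj_image_mem_iff)
next
  case (alpha_Res z1 z2 P P' y1 y2 y1' y2')
  then show ?case
    using alpha.alpha_Res[of "f z1" "f z2" "rename f P" "rename f P'" "f y1" "f y2" "f y1'" "f y2'"]
      assms(2)
    by (auto simp: rename_update2 raw_process.set_map inj_eq inj_image_mem_iff)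
qed (auto intro: alpha.intros)

lemma alpha_rename_on:
  assumes "alpha P Q" "inj_on f (names P \<union> names Q)"
  shows "alpha (rename f P) (rename f Q)"
proof -
  let ?S = "names P \<union> names Q"
  have fin: "finite ?S" by (simp add: finite_names)
  obtain k where k: "\<forall>a \<in> ?S \<union> f ` ?S. a < k"
    using fin by (meson finite_nat_set_iff_bounded finite_UnI finite_imageI)
  define g where "g a = (if a \<in> ?S then f a else a + k)" for a
  have "inj g"
  proof (rule injI)
    fix a b assume eq: "g a = g b"
    have "f c < k" if "c \<in> ?S" for c using k that by blast
    with eq assms(2) show "a = b"
      by (auto simp: g_def inj_on_def split: if_splits dest: leD)
        (metis le_add2 leD)+
  qed
  then have "alpha (rename g P) (rename g Q)" using assms(1) by (rule alpha_rename[rotated])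
  moreover have "rename g P = rename f P" "rename g Q = rename f Q"
    by (auto simp: g_def intro!: raw_process.map_cong0)
  ultimately show ?thesis by simp
qed

lemma alpha_fresh1:
  assumes "alpha (rename (id(y := z)) P) (rename (id(y' := z)) P')"
    and "z \<notin> names P \<union> names P'" "w \<notin> names P \<union> names P'"
  shows "alpha (rename (id(y := w)) P) (rename (id(y' := w)) P')"
proof -
  have *: "rename (transpose z w) (rename (id(v := z)) R) = rename (id(v := w)) R"
    if "z \<notin> names R" "w \<notin> names R" for v R
    using that by (auto simp: raw_process.map_comp transpose_def intro!: raw_process.map_cong0)
  show ?thesis
    using alpha_rename[OF assms(1), of "transpose z w"] assms(2,3) by (simp add: *)
qed

lemma alpha_fresh2:
  assumes "alpha (rename (id(y1 := z1, y2 := z2)) P) (rename (id(y1' := z1, y2' := z2)) P')"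
    and "z1 \<noteq> z2" "z1 \<notin> names P \<union> names P'" "z2 \<notin> names P \<union> names P'"
    and "w1 \<noteq> w2" "w1 \<notin> names P \<union> names P' \<union> {z1, z2}" "w2 \<notin> names P \<union> names P' \<union> {z1, z2}"
  shows "alpha (rename (id(y1 := w1, y2 := w2)) P) (rename (id(y1' := w1, y2' := w2)) P')"
proof -
  let ?f = "transpose z1 w1 \<circ> transpose z2 w2"
  have *: "rename ?f (rename (id(v1 := z1, v2 := z2)) R) = rename (id(v1 := w1, v2 := w2)) R"
    if "{z1, z2, w1, w2} \<inter> names R = {}" for v1 v2 R
    using that assms
    by (auto simp: raw_process.map_comp transpose_def intro!: raw_process.map_cong0)
  have "inj ?f" by (simp add: inj_compose)
  moreover have "{z1, z2, w1, w2} \<inter> names P = {}" "{z1, z2, w1, w2} \<inter> names P' = {}"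
    using assms by auto
  ultimately show ?thesis
    using alpha_rename[OF assms(1), of ?f] by (metis *)
qed

lemma obtain_fresh2:
  assumes "finite S"
  obtains z1 z2 :: name where "z1 \<noteq> z2" "z1 \<notin> S" "z2 \<notin> S"
proof -
  obtain z1 where "z1 \<notin> S" using ex_new_if_finite[OF infinite_UNIV_nat assms] by blast
  moreover obtain z2 where "z2 \<notin> insert z1 S"
    using ex_new_if_finite[OF infinite_UNIV_nat, of "insert z1 S"] assms by blast
  ultimately show thesis using that[of z1 z2] by blast
qed

lemma alpha_cong1:
  assumes "alpha P Q"
  shows "\<exists>z. z \<notin> names P \<union> names Q \<and> alpha (rename (id(y := z)) P) (rename (id(y := z)) Q)"
proof -
  obtain z where z: "z \<notin> names P \<union> names Q"
    using ex_new_if_finite[OF infinite_UNIV_nat, of "names P \<union> names Q"] finite_names by auto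
  then have "inj_on (id(y := z)) (names P \<union> names Q)" by (auto simp: inj_on_def)
  with assms z show ?thesis by (blast intro: alpha_rename_on)
qed

lemma alpha_cong2:
  assumes "alpha P Q"
  shows "\<exists>z1 z2. z1 \<noteq> z2 \<and> z1 \<notin> names P \<union> names Q \<and> z2 \<notin> names P \<union> names Q
    \<and> alpha (rename (id(y1 := z1, y2 := z2)) P) (rename (id(y1 := z1, y2 := z2)) Q)"
proof -
  obtain z1 z2 where z: "z1 \<noteq> z2" "z1 \<notin> names P \<union> names Q" "z2 \<notin> names P \<union> names Q"
    by (rule obtain_fresh2[of "names P \<union> names Q"]) (auto simp: finite_names)
  then have "inj_on (id(y1 := z1, y2 := z2)) (names P \<union> names Q)" by (auto simp: inj_on_def)
  with assms z show ?thesis by (blast intro: alpha_rename_on)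
qed

lemma alpha_congs:
  assumes "alpha P Q"
  shows "alpha (ROut x y P) (ROut x y Q)" "alpha (RInp x y P) (RInp x y Q)"
    "alpha (RServer x y P) (RServer x y Q)" "alpha (RClient x y P) (RClient x y Q)"
    "alpha (RDup x y1 y2 P) (RDup x y1 y2 Q)" "alpha (RRes y1 y2 P) (RRes y1 y2 Q)"
proof -
  obtain z where z: "z \<notin> names P \<union> names Q" "alpha (rename (id(y := z)) P) (rename (id(y := z)) Q)"
    using alpha_cong1[OF assms] by blast
  show "alpha (ROut x y P) (ROut x y Q)" "alpha (RInp x y P) (RInp x y Q)"
    "alpha (RServer x y P) (RServer x y Q)" "alpha (RClient x y P) (RClient x y Q)"
    using z by (rule alpha.intros)+
  obtain z1 z2 where z: "z1 \<noteq> z2" "z1 \<notin> names P \<union> names Q" "z2 \<notin> names P \<union> names Q"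
    "alpha (rename (id(y1 := z1, y2 := z2)) P) (rename (id(y1 := z1, y2 := z2)) Q)"
    using alpha_cong2[OF assms] by blast
  show "alpha (RDup x y1 y2 P) (RDup x y1 y2 Q)" "alpha (RRes y1 y2 P) (RRes y1 y2 Q)"
    using z by (rule alpha.intros)+
qed

lemma alpha_refl: "alpha P P"
  by (induction P) (auto intro: alpha_congs alpha.intros(3-7,11,13-))

lemma alpha_sym: "alpha P Q \<Longrightarrow> alpha Q P"
  by (induction rule: alpha.induct) (auto intro: alpha.intros)

lemma size_rename: "size (rename f P) = size P"
  by (induction P) auto

lemma alpha_trans1:
  assumes "alpha (rename (id(y := z)) P) (rename (id(y' := z)) P')" "z \<notin> names P \<union> names P'"
    and "alpha (rename (id(y' := z')) P') (rename (id(y'' := z')) P'')" "z' \<notin> names P' \<union> names P''"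
    and IH: "\<forall>f Q R. alpha (rename f P) Q \<longrightarrow> alpha Q R \<longrightarrow> alpha (rename f P) R"
  shows "\<exists>w. w \<notin> names P \<union> names P'' \<and> alpha (rename (id(y := w)) P) (rename (id(y'' := w)) P'')"
proof -
  obtain w where w: "w \<notin> names P \<union> names P' \<union> names P''"
    using ex_new_if_finite[OF infinite_UNIV_nat, of "names P \<union> names P' \<union> names P''"]
      finite_names by auto
  then have "alpha (rename (id(y := w)) P) (rename (id(y' := w)) P')"
    "alpha (rename (id(y' := w)) P') (rename (id(y'' := w)) P'')"
    using alpha_fresh1[OF assms(1,2)] alpha_fresh1[OF assms(3,4)] by auto
  with w IH show ?thesis by blast
qed

lemma alpha_trans2:
  assumes "alpha (rename (id(y1 := z1, y2 := z2)) P) (rename (id(y1' := z1, y2' := z2)) P')"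
    "z1 \<noteq> z2" "z1 \<notin> names P \<union> names P'" "z2 \<notin> names P \<union> names P'"
    and "alpha (rename (id(y1' := z1', y2' := z2')) P') (rename (id(y1'' := z1', y2'' := z2')) P'')"
    "z1' \<noteq> z2'" "z1' \<notin> names P' \<union> names P''" "z2' \<notin> names P' \<union> names P''"
    and IH: "\<forall>f Q R. alpha (rename f P) Q \<longrightarrow> alpha Q R \<longrightarrow> alpha (rename f P) R"
  shows "\<exists>w1 w2. w1 \<noteq> w2 \<and> w1 \<notin> names P \<union> names P'' \<and> w2 \<notin> names P \<union> names P'' \<and>
    alpha (rename (id(y1 := w1, y2 := w2)) P) (rename (id(y1'' := w1, y2'' := w2)) P'')"
proof -
  let ?S = "names P \<union> names P' \<union> names P'' \<union> {z1, z2, z1', z2'}"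
  obtain w1 w2 where w: "w1 \<noteq> w2" "w1 \<notin> ?S" "w2 \<notin> ?S"
    by (rule obtain_fresh2[of ?S]) (auto simp: finite_names)
  then have "alpha (rename (id(y1 := w1, y2 := w2)) P) (rename (id(y1' := w1, y2' := w2)) P')"
    "alpha (rename (id(y1' := w1, y2' := w2)) P') (rename (id(y1'' := w1, y2'' := w2)) P'')"
    using alpha_fresh2[OF assms(1-4)] alpha_fresh2[OF assms(5-8)] by auto
  with w IH show ?thesis by blast
qed

inductive_cases alpha_elims:
  "alpha (ROut x y P) R" "alpha (RInp x y P) R" "alpha (RClose x P) R" "alpha (RWait x P) R"
  "alpha (RSelL x P) R" "alpha (RSelR x P) R" "alpha (RCase x P Q) R" "alpha (RServer x y P) R"
  "alpha (RClient x y P) R" "alpha (RDup x y1 y2 P) R" "alpha (RDisp x P) R" "alpha (RRes y1 y2 P) R"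
  "alpha (RPar P Q) R" "alpha RNil R" "alpha (RLink x y) R"

lemma alpha_trans: "alpha P Q \<Longrightarrow> alpha Q R \<Longrightarrow> alpha P R"
proof (induction "size P" arbitrary: P Q R rule: less_induct)
  case less
  have IH: "alpha (rename f P') Q' \<Longrightarrow> alpha Q' R' \<Longrightarrow> alpha (rename f P') R'"
    if "size P' < size P" for f P' Q' R'
    using less.hyps[of "rename f P'"] that by (simp add: size_rename)
  have IH': "alpha P' Q' \<Longrightarrow> alpha Q' R' \<Longrightarrow> alpha P' R'" if "size P' < size P" for P' Q' R'
    using less.hyps that by blast
  from less.prems(1) show ?case
  proof cases
    case (alpha_Out z P1 Q1 y y' x)
    from less.prems(2)[unfolded alpha_Out(2)] obtain z' R1 y'' where R: "R = ROut x y'' R1"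
      "z' \<notin> names Q1 \<union> names R1" "alpha (rename (id(y' := z')) Q1) (rename (id(y'' := z')) R1)"
      by (elim alpha_elims(1)) blast
    have IH1: "\<forall>f Q' R'. alpha (rename f P1) Q' \<longrightarrow> alpha Q' R' \<longrightarrow> alpha (rename f P1) R'"
      using IH[of P1] by (simp add: alpha_Out(1))
    from alpha_trans1[OF alpha_Out(4,3) R(3,2) IH1]
    show ?thesis unfolding alpha_Out(1) R(1) by (blast intro: alpha.alpha_Out)
  next
    case (alpha_Inp z P1 Q1 y y' x)
    from less.prems(2)[unfolded alpha_Inp(2)] obtain z' R1 y'' where R: "R = RInp x y'' R1"
      "z' \<notin> names Q1 \<union> names R1" "alpha (rename (id(y' := z')) Q1) (rename (id(y'' := z')) R1)"
      by (elim alpha_elims(2)) blast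
    have IH1: "\<forall>f Q' R'. alpha (rename f P1) Q' \<longrightarrow> alpha Q' R' \<longrightarrow> alpha (rename f P1) R'"
      using IH[of P1] by (simp add: alpha_Inp(1))
    from alpha_trans1[OF alpha_Inp(4,3) R(3,2) IH1]
    show ?thesis unfolding alpha_Inp(1) R(1) by (blast intro: alpha.alpha_Inp)
  next
    case (alpha_Server z P1 Q1 y y' x)
    from less.prems(2)[unfolded alpha_Server(2)] obtain z' R1 y'' where R: "R = RServer x y'' R1"
      "z' \<notin> names Q1 \<union> names R1" "alpha (rename (id(y' := z')) Q1) (rename (id(y'' := z')) R1)"
      by (elim alpha_elims(8)) blast
    have IH1: "\<forall>f Q' R'. alpha (rename f P1) Q' \<longrightarrow> alpha Q' R' \<longrightarrow> alpha (rename f P1) R'"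
      using IH[of P1] by (simp add: alpha_Server(1))
    from alpha_trans1[OF alpha_Server(4,3) R(3,2) IH1]
    show ?thesis unfolding alpha_Server(1) R(1) by (blast intro: alpha.alpha_Server)
  next
    case (alpha_Client z P1 Q1 y y' x)
    from less.prems(2)[unfolded alpha_Client(2)] obtain z' R1 y'' where R: "R = RClient x y'' R1"
      "z' \<notin> names Q1 \<union> names R1" "alpha (rename (id(y' := z')) Q1) (rename (id(y'' := z')) R1)"
      by (elim alpha_elims(9)) blast
    have IH1: "\<forall>f Q' R'. alpha (rename f P1) Q' \<longrightarrow> alpha Q' R' \<longrightarrow> alpha (rename f P1) R'"
      using IH[of P1] by (simp add: alpha_Client(1))
    from alpha_trans1[OF alpha_Client(4,3) R(3,2) IH1]
    show ?thesis unfolding alpha_Client(1) R(1) by (blast intro: alpha.alpha_Client)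
  next
    case (alpha_Dup z1 z2 P1 Q1 y1 y2 y1' y2' x)
    from less.prems(2)[unfolded alpha_Dup(2)] obtain z1' z2' R1 y1'' y2'' where R: "R = RDup x y1'' y2'' R1"
      "z1' \<noteq> z2'" "z1' \<notin> names Q1 \<union> names R1" "z2' \<notin> names Q1 \<union> names R1"
      "alpha (rename (id(y1' := z1', y2' := z2')) Q1) (rename (id(y1'' := z1', y2'' := z2')) R1)"
      by (elim alpha_elims(10)) blast
    have IH1: "\<forall>f Q' R'. alpha (rename f P1) Q' \<longrightarrow> alpha Q' R' \<longrightarrow> alpha (rename f P1) R'"
      using IH[of P1] by (simp add: alpha_Dup(1))
    from alpha_trans2[OF alpha_Dup(6,3-5) R(5,2-4) IH1]
    show ?thesis unfolding alpha_Dup(1) R(1) by (blast intro: alpha.alpha_Dup)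
  next
    case (alpha_Res z1 z2 P1 Q1 y1 y2 y1' y2')
    from less.prems(2)[unfolded alpha_Res(2)] obtain z1' z2' R1 y1'' y2'' where R: "R = RRes y1'' y2'' R1"
      "z1' \<noteq> z2'" "z1' \<notin> names Q1 \<union> names R1" "z2' \<notin> names Q1 \<union> names R1"
      "alpha (rename (id(y1' := z1', y2' := z2')) Q1) (rename (id(y1'' := z1', y2'' := z2')) R1)"
      by (elim alpha_elims(12)) blast
    have IH1: "\<forall>f Q' R'. alpha (rename f P1) Q' \<longrightarrow> alpha Q' R' \<longrightarrow> alpha (rename f P1) R'"
      using IH[of P1] by (simp add: alpha_Res(1))
    from alpha_trans2[OF alpha_Res(6,3-5) R(5,2-4) IH1]
    show ?thesis unfolding alpha_Res(1) R(1) by (blast intro: alpha.alpha_Res)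
  qed (use less.prems(2) in \<open>auto elim!: alpha_elims intro!: alpha.intros(3-7,11,13-15) elim: IH'[rotated]\<close>)
qed

quotient_type process = "name raw_process" / alpha
  by (intro equivpI reflpI sympI transpI) (blast intro: alpha_refl alpha_sym alpha_trans)+

lift_definition Out :: "name \<Rightarrow> name \<Rightarrow> process \<Rightarrow> process" is ROut by (rule alpha_congs)
lift_definition Inp :: "name \<Rightarrow> name \<Rightarrow> process \<Rightarrow> process" is RInp by (rule alpha_congs)
lift_definition Close :: "name \<Rightarrow> process \<Rightarrow> process" is RClose by (rule alpha.intros)
lift_definition Wait :: "name \<Rightarrow> process \<Rightarrow> process" is RWait by (rule alpha.intros)
lift_definition SelL :: "name \<Rightarrow> process \<Rightarrow> process" is RSelL by (rule alpha.intros)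
lift_definition SelR :: "name \<Rightarrow> process \<Rightarrow> process" is RSelR by (rule alpha.intros)
lift_definition Case :: "name \<Rightarrow> process \<Rightarrow> process \<Rightarrow> process" is RCase by (rule alpha.intros)
lift_definition Server :: "name \<Rightarrow> name \<Rightarrow> process \<Rightarrow> process" is RServer by (rule alpha_congs)
lift_definition Client :: "name \<Rightarrow> name \<Rightarrow> process \<Rightarrow> process" is RClient by (rule alpha_congs)
lift_definition Dup :: "name \<Rightarrow> name \<Rightarrow> name \<Rightarrow> process \<Rightarrow> process" is RDup by (rule alpha_congs)
lift_definition Disp :: "name \<Rightarrow> process \<Rightarrow> process" is RDisp by (rule alpha.intros)
lift_definition Res :: "name \<Rightarrow> name \<Rightarrow> process \<Rightarrow> process" is RRes by (rule alpha_congs)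
lift_definition Par :: "process \<Rightarrow> process \<Rightarrow> process" is RPar by (rule alpha.intros)
lift_definition Nil0 :: process is RNil .
lift_definition Link :: "name \<Rightarrow> name \<Rightarrow> process" is RLink .


(* Environments and hyperenvironments are multisets: "," is + on the inner level, "|" is +
   on the outer level, {#} is the empty (hyper)environment, and a hyperenvironment may
   contain (several copies of) the empty environment.  Distinctness of names is expressed
   by \<open>distinct_names\<close> / \<open>hyperenv\<close>. *)
type_synonym env = "(name \<times> ty) multiset"
type_synonym henv = "env multiset"
type_synonym name_partition = "name multiset multiset"

definition distinct_names :: "name_partition \<Rightarrow> bool" where
  "distinct_names N \<longleftrightarrow> (\<forall>x. count (\<Sum>\<^sub># N) x \<le> 1)"

definition strip :: "henv \<Rightarrow> name_partition" where
  "strip \<G> = image_mset (image_mset fst) \<G>"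

definition hyperenv :: "henv \<Rightarrow> bool" where
  "hyperenv \<G> \<longleftrightarrow> distinct_names (strip \<G>)"

definition shuffling :: "henv \<Rightarrow> henv \<Rightarrow> bool" where
  "shuffling \<G> \<G>' \<longleftrightarrow>
     size {#\<Gamma> \<in># \<G>. \<Gamma> \<noteq> {#}#} = size {#\<Gamma> \<in># \<G>'. \<Gamma> \<noteq> {#}#} \<and>
     (\<forall>x A. (\<exists>\<Gamma> \<in># \<G>. (x, A) \<in># \<Gamma>) \<longleftrightarrow> (\<exists>\<Gamma> \<in># \<G>'. (x, A) \<in># \<Gamma>))"

definition all_whynot :: "env \<Rightarrow> bool" where
  "all_whynot \<Gamma> \<longleftrightarrow> (\<forall>(x, A) \<in># \<Gamma>. \<exists>B. A = WhyNot B)"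

(* The presupposition that the names of a hyperenvironment are distinct is an explicit
   premise of every rule whose conclusion does not inherit it from the premises. *)
inductive typing :: "process \<Rightarrow> henv \<Rightarrow> bool"  ("(\<turnstile> _ \<Colon> _)" [61, 61] 60) where
  T_Ax: "hyperenv {#{#(x, dual A), (y, A)#}#} \<Longrightarrow>
    \<turnstile> Link x y \<Colon> {#{#(x, dual A), (y, A)#}#}"
| T_Cut: "\<turnstile> P \<Colon> \<G> + {#\<Gamma> + {#(x, A)#}, \<Delta> + {#(y, dual A)#}#} \<Longrightarrow>
    \<turnstile> Res x y P \<Colon> \<G> + {#\<Gamma> + \<Delta>#}"
| T_Mix: "\<turnstile> P \<Colon> \<G> \<Longrightarrow> \<turnstile> Q \<Colon> \<H> \<Longrightarrow> hyperenv (\<G> + \<H>) \<Longrightarrow>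
    \<turnstile> Par P Q \<Colon> \<G> + \<H>"
| T_Mix0: "\<turnstile> Nil0 \<Colon> {#}"
| T_Tensor: "\<turnstile> P \<Colon> \<G> + {#\<Gamma> + {#(y, A)#}, \<Delta> + {#(x, B)#}#} \<Longrightarrow>
    \<turnstile> Out x y P \<Colon> \<G> + {#\<Gamma> + \<Delta> + {#(x, Tensor A B)#}#}"
| T_One: "\<turnstile> P \<Colon> \<G> \<Longrightarrow> hyperenv (\<G> + {#{#(x, One)#}#}) \<Longrightarrow>
    \<turnstile> Close x P \<Colon> \<G> + {#{#(x, One)#}#}"
| T_Parr: "\<turnstile> P \<Colon> \<G> + {#\<Gamma> + {#(y, A), (x, B)#}#} \<Longrightarrow>
    \<turnstile> Inp x y P \<Colon> \<G> + {#\<Gamma> + {#(x, Parr A B)#}#}"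
| T_Bot: "\<turnstile> P \<Colon> \<G> + {#\<Gamma>#} \<Longrightarrow> hyperenv (\<G> + {#\<Gamma> + {#(x, Bot)#}#}) \<Longrightarrow>
    \<turnstile> Wait x P \<Colon> \<G> + {#\<Gamma> + {#(x, Bot)#}#}"
| T_Plus1: "\<turnstile> P \<Colon> \<G> + {#\<Gamma> + {#(x, A)#}#} \<Longrightarrow>
    \<turnstile> SelL x P \<Colon> \<G> + {#\<Gamma> + {#(x, Plus A B)#}#}"
| T_Plus2: "\<turnstile> P \<Colon> \<G> + {#\<Gamma> + {#(x, B)#}#} \<Longrightarrow>
    \<turnstile> SelR x P \<Colon> \<G> + {#\<Gamma> + {#(x, Plus A B)#}#}"
| T_With: "\<turnstile> P \<Colon> {#\<Gamma> + {#(x, A)#}#} \<Longrightarrow> \<turnstile> Q \<Colon> {#\<Gamma> + {#(x, B)#}#} \<Longrightarrow>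
    \<turnstile> Case x P Q \<Colon> {#\<Gamma> + {#(x, With A B)#}#}"
| T_OfCourse: "\<turnstile> P \<Colon> {#\<Gamma> + {#(y, A)#}#} \<Longrightarrow> all_whynot \<Gamma> \<Longrightarrow>
    hyperenv {#\<Gamma> + {#(x, OfCourse A)#}#} \<Longrightarrow>
    \<turnstile> Server x y P \<Colon> {#\<Gamma> + {#(x, OfCourse A)#}#}"
| T_WhyNot: "\<turnstile> P \<Colon> \<G> + {#\<Gamma> + {#(y, A)#}#} \<Longrightarrow>
    hyperenv (\<G> + {#\<Gamma> + {#(x, WhyNot A)#}#}) \<Longrightarrow>
    \<turnstile> Client x y P \<Colon> \<G> + {#\<Gamma> + {#(x, WhyNot A)#}#}"
| T_Weaken: "\<turnstile> P \<Colon> \<G> + {#\<Gamma>#} \<Longrightarrow> hyperenv (\<G> + {#\<Gamma> + {#(x, WhyNot A)#}#}) \<Longrightarrow>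
    \<turnstile> Disp x P \<Colon> \<G> + {#\<Gamma> + {#(x, WhyNot A)#}#}"
| T_Contract: "\<turnstile> P \<Colon> \<G> + {#\<Gamma> + {#(x1, WhyNot A), (x2, WhyNot A)#}#} \<Longrightarrow>
    hyperenv (\<G> + {#\<Gamma> + {#(x, WhyNot A)#}#}) \<Longrightarrow>
    \<turnstile> Dup x x1 x2 P \<Colon> \<G> + {#\<Gamma> + {#(x, WhyNot A)#}#}"

inductive partitioning :: "process \<Rightarrow> name_partition \<Rightarrow> bool"  ("(_ \<tturnstile> _)" [61, 61] 60) where
  P_Ax: "distinct_names {#{#x, y#}#} \<Longrightarrow>
    Link x y \<tturnstile> {#{#x, y#}#}"
| P_Cut: "P \<tturnstile> G + {#\<Gamma> + {#x#}, \<Delta> + {#y#}#} \<Longrightarrow>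
    Res x y P \<tturnstile> G + {#\<Gamma> + \<Delta>#}"
| P_Mix: "P \<tturnstile> G \<Longrightarrow> Q \<tturnstile> H \<Longrightarrow> distinct_names (G + H) \<Longrightarrow>
    Par P Q \<tturnstile> G + H"
| P_Mix0: "Nil0 \<tturnstile> {#}"
| P_Tensor: "P \<tturnstile> G + {#\<Gamma> + {#y#}, \<Delta> + {#x#}#} \<Longrightarrow>
    Out x y P \<tturnstile> G + {#\<Gamma> + \<Delta> + {#x#}#}"
| P_One: "P \<tturnstile> G \<Longrightarrow> distinct_names (G + {#{#x#}#}) \<Longrightarrow>
    Close x P \<tturnstile> G + {#{#x#}#}"
| P_Parr: "P \<tturnstile> G + {#\<Gamma> + {#y, x#}#} \<Longrightarrow>
    Inp x y P \<tturnstile> G + {#\<Gamma> + {#x#}#}"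
| P_Bot: "P \<tturnstile> G + {#\<Gamma>#} \<Longrightarrow> distinct_names (G + {#\<Gamma> + {#x#}#}) \<Longrightarrow>
    Wait x P \<tturnstile> G + {#\<Gamma> + {#x#}#}"
| P_Plus1: "P \<tturnstile> G + {#\<Gamma> + {#x#}#} \<Longrightarrow>
    SelL x P \<tturnstile> G + {#\<Gamma> + {#x#}#}"
| P_Plus2: "P \<tturnstile> G + {#\<Gamma> + {#x#}#} \<Longrightarrow>
    SelR x P \<tturnstile> G + {#\<Gamma> + {#x#}#}"
| P_With: "P \<tturnstile> {#\<Gamma> + {#x#}#} \<Longrightarrow> Q \<tturnstile> {#\<Gamma> + {#x#}#} \<Longrightarrow>
    Case x P Q \<tturnstile> {#\<Gamma> + {#x#}#}"
| P_OfCourse: "P \<tturnstile> {#\<Gamma> + {#y#}#} \<Longrightarrow> distinct_names {#\<Gamma> + {#x#}#} \<Longrightarrow>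
    Server x y P \<tturnstile> {#\<Gamma> + {#x#}#}"
| P_WhyNot: "P \<tturnstile> G + {#\<Gamma> + {#y#}#} \<Longrightarrow> distinct_names (G + {#\<Gamma> + {#x#}#}) \<Longrightarrow>
    Client x y P \<tturnstile> G + {#\<Gamma> + {#x#}#}"
| P_Weaken: "P \<tturnstile> G + {#\<Gamma>#} \<Longrightarrow> distinct_names (G + {#\<Gamma> + {#x#}#}) \<Longrightarrow>
    Disp x P \<tturnstile> G + {#\<Gamma> + {#x#}#}"
| P_Contract: "P \<tturnstile> G + {#\<Gamma> + {#x1, x2#}#} \<Longrightarrow> distinct_names (G + {#\<Gamma> + {#x#}#}) \<Longrightarrow>
    Dup x x1 x2 P \<tturnstile> G + {#\<Gamma> + {#x#}#}"

lemma distinct_names_mono: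
  "distinct_names M \<Longrightarrow> \<Sum>\<^sub># N \<subseteq># \<Sum>\<^sub># M \<Longrightarrow> distinct_names N"
  unfolding distinct_names_def by (meson le_trans mset_subset_eq_count)

lemma typing_hyperenv: "\<turnstile> P \<Colon> \<G> \<Longrightarrow> hyperenv \<G>"
proof (induction rule: typing.induct)
  case T_Mix0
  show ?case by (simp add: hyperenv_def distinct_names_def strip_def)
next
  case (T_Cut P \<G> \<Gamma> x A \<Delta> y)
  show ?case using T_Cut.IH unfolding hyperenv_def
    by (rule distinct_names_mono) (simp add: strip_def subseteq_mset_def)
next
  case (T_Tensor P \<G> \<Gamma> y A \<Delta> x B)
  show ?case using T_Tensor.IH unfolding hyperenv_def
    by (rule distinct_names_mono) (simp add: strip_def subseteq_mset_def)
next
  case (T_Parr P \<G> \<Gamma> y A x B)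
  show ?case using T_Parr.IH unfolding hyperenv_def
    by (rule distinct_names_mono) (simp add: strip_def subseteq_mset_def)
qed (simp_all add: hyperenv_def strip_def)

lemma partitioning_distinct_names: "P \<tturnstile> N \<Longrightarrow> distinct_names N"
proof (induction rule: partitioning.induct)
  case P_Mix0
  show ?case by (simp add: distinct_names_def)
next
  case (P_Cut P G \<Gamma> x \<Delta> y)
  show ?case using P_Cut.IH by (rule distinct_names_mono) (simp add: subseteq_mset_def)
next
  case (P_Tensor P G \<Gamma> y \<Delta> x)
  show ?case using P_Tensor.IH by (rule distinct_names_mono) (simp add: subseteq_mset_def)
next
  case (P_Parr P G \<Gamma> y x)
  show ?case using P_Parr.IH by (rule distinct_names_mono) (simp add: subseteq_mset_def)
qed assumption+

end

theory Submission
  imports Defs "HOL-Combinatorics.Perm"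
begin

text \<open>
  Since names are distinct, two shufflings have the same typed names as multisets. By induction on
  the typing derivation, the partition derivation dictates where each rule splits the
  hyperenvironment, while the typing derivation supplies the types of the principal and bound names;
  the two agree because a name carries only one type, and a parallel composition distributes its
  typed names according to the free names of its components. As processes are taken up to alpha,
  the partition derivation may use other bound names than the typing derivation, so partitions are
  inverted modulo a permutation of names that fixes the free names.
\<close>

unbundle permutation_syntax
lifting_forget perm.lifting \<comment> \<open>\<open>transfer\<close> must not descend into permutations\<close>

section \<open>Multisets without repetition\<close>

definition distinct_mset :: "'a multiset \<Rightarrow> bool" where
  "distinct_mset M \<longleftrightarrow> (\<forall>x. count M x \<le> 1)"

lemma distinct_mset_empty [simp]: "distinct_mset {#}"
  by (simp add: distinct_mset_def)

lemma distinct_mset_add_mset [simp]: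
  "distinct_mset (add_mset x M) \<longleftrightarrow> x \<notin># M \<and> distinct_mset M"
proof -
  have "count (add_mset x M) y \<le> 1 \<longleftrightarrow> (y = x \<longrightarrow> x \<notin># M) \<and> count M y \<le> 1" for y
    by (auto simp: not_in_iff)
  then show ?thesis
    unfolding distinct_mset_def by blast
qed

lemma distinct_mset_union [simp]:
  "distinct_mset (M + N) \<longleftrightarrow> distinct_mset M \<and> distinct_mset N \<and> set_mset M \<inter> set_mset N = {}"
  by (induction M) auto

lemma distinct_mset_image_mset [simp]:
  "distinct_mset (image_mset f M) \<longleftrightarrow> distinct_mset M \<and> inj_on f (set_mset M)"
  by (induction M) auto

lemma mset_set_set_mset: "distinct_mset M \<Longrightarrow> mset_set (set_mset M) = M"
  by (induction M) auto

lemma Sum_mset_image_image_mset [simp]: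
  "\<Sum>\<^sub># (image_mset (image_mset f) N) = image_mset f (\<Sum>\<^sub># N)"
  by (induction N) auto

lemma distinct_names_iff: "distinct_names N \<longleftrightarrow> distinct_mset (\<Sum>\<^sub># N)"
  by (simp add: distinct_names_def distinct_mset_def)

section \<open>Permutations of names and alpha-equivalence\<close>

lemma perm_extending_inj_onE:
  assumes "finite A" "inj_on f A"
  obtains \<pi> where "\<And>a. a \<in> A \<Longrightarrow> \<pi> \<langle>$\<rangle> a = f a"
  using assms
proof (induction arbitrary: thesis rule: finite_induct)
  case empty
  then show ?case by blast
next
  case (insert a A)
  then obtain \<pi> where \<pi>: "\<pi> \<langle>$\<rangle> b = f b" if "b \<in> A" for b
    by auto
  show ?case
  proof (rule insert.prems(1))
    fix b assume "b \<in> insert a A"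
    then consider "b = a" | "b \<in> A" "b \<noteq> a" "f b \<noteq> f a"
      using insert.hyps(2) insert.prems(2) by (metis inj_on_eq_iff insert_iff)
    then show "(\<langle>\<pi> \<langle>$\<rangle> a \<leftrightarrow> f a\<rangle> * \<pi>) \<langle>$\<rangle> b = f b"
      by cases (simp_all add: apply_times apply_inj flip: \<pi>)
  qed
qed

lemma inj_apply [simp]: "inj (apply \<pi>)"
  by (simp add: bij_is_inj)

primrec raw_fn :: "'n raw_process \<Rightarrow> 'n set" where
  "raw_fn (ROut x y P) = insert x (raw_fn P - {y})"
| "raw_fn (RInp x y P) = insert x (raw_fn P - {y})"
| "raw_fn (RClose x P) = insert x (raw_fn P)"
| "raw_fn (RWait x P) = insert x (raw_fn P)"
| "raw_fn (RSelL x P) = insert x (raw_fn P)"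
| "raw_fn (RSelR x P) = insert x (raw_fn P)"
| "raw_fn (RCase x P Q) = insert x (raw_fn P \<union> raw_fn Q)"
| "raw_fn (RServer x y P) = insert x (raw_fn P - {y})"
| "raw_fn (RClient x y P) = insert x (raw_fn P - {y})"
| "raw_fn (RDup x y1 y2 P) = insert x (raw_fn P - {y1, y2})"
| "raw_fn (RDisp x P) = insert x (raw_fn P)"
| "raw_fn (RRes y1 y2 P) = raw_fn P - {y1, y2}"
| "raw_fn (RPar P Q) = raw_fn P \<union> raw_fn Q"
| "raw_fn RNil = {}"
| "raw_fn (RLink x y) = {x, y}"

lemma raw_fn_subset_names: "raw_fn P \<subseteq> names P"
  by (induction P) auto

lemma raw_fn_rename_inj: "inj f \<Longrightarrow> raw_fn (rename f P) = f ` raw_fn P"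
  by (induction P) (simp_all add: image_set_diff image_Un)

text \<open>\<open>f ` Y\<close> may be a proper subset of \<open>Z\<close>: a double binder that repeats a name is freshened by two
  names, the first of which remains unused.\<close>

definition freshening ::
    "(name \<Rightarrow> name) \<Rightarrow> name set \<Rightarrow> name set \<Rightarrow> name raw_process \<Rightarrow> bool" where
  "freshening f Y Z P \<longleftrightarrow> finite Y \<and> inj_on f (Y \<union> names P) \<and> (\<forall>a. a \<notin> Y \<longrightarrow> f a = a)
    \<and> f ` Y \<subseteq> Z \<and> Z \<inter> names P = {}"

lemma freshening_single: "z \<notin> names P \<Longrightarrow> freshening (id(y := z)) {y} {z} P"
  by (auto simp: freshening_def inj_on_def)

lemma freshening_pair:
  assumes "z1 \<noteq> z2" "z1 \<notin> names P" "z2 \<notin> names P"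
  shows "freshening (id(y1 := z1, y2 := z2)) {y1, y2} {z1, z2} P"
  using assms by (auto simp: freshening_def inj_on_def)

lemma freshening_permE:
  assumes "freshening f Y Z P"
  obtains \<pi> where "\<And>a. a \<in> Y \<union> names P \<Longrightarrow> \<pi> \<langle>$\<rangle> a = f a" "rename f P = rename (apply \<pi>) P"
proof -
  obtain \<pi> where \<pi>: "\<And>a. a \<in> Y \<union> names P \<Longrightarrow> \<pi> \<langle>$\<rangle> a = f a"
    using assms perm_extending_inj_onE[of "Y \<union> names P" f]
    by (auto simp: freshening_def finite_names)
  have "rename f P = rename (apply \<pi>) P"
    by (rule raw_process.map_cong0) (simp add: \<pi>)
  with \<pi> show thesis by (rule that)
qed

lemma raw_fn_freshening:
  assumes "freshening f Y Z P"
  shows "raw_fn (rename f P) - Z = raw_fn P - Y"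
proof -
  obtain \<pi> where \<pi>: "\<And>a. a \<in> Y \<union> names P \<Longrightarrow> \<pi> \<langle>$\<rangle> a = f a" "rename f P = rename (apply \<pi>) P"
    using freshening_permE[OF assms] by blast
  have "raw_fn (rename f P) = apply \<pi> ` raw_fn P"
    by (simp add: \<pi>(2) raw_fn_rename_inj)
  also have "\<dots> = f ` raw_fn P"
    by (rule image_cong) (use raw_fn_subset_names[of P] in \<open>auto simp: \<pi>(1)\<close>)
  also have "\<dots> - Z = raw_fn P - Y"
  proof -
    have "f a \<in> Z \<longleftrightarrow> a \<in> Y" "a \<notin> Y \<Longrightarrow> f a = a" if "a \<in> raw_fn P" for a
      using assms that raw_fn_subset_names[of P] by (auto simp: freshening_def)
    then show ?thesis by (force intro: rev_image_eqI)
  qed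
  finally show ?thesis .
qed

lemma raw_fn_diff_eqI:
  assumes "raw_fn (rename f P) = raw_fn (rename f' P')"
    and "freshening f Y Z P" "freshening f' Y' Z P'"
  shows "raw_fn P - Y = raw_fn P' - Y'"
  using assms raw_fn_freshening by metis

lemma alpha_raw_fn: "alpha P Q \<Longrightarrow> raw_fn P = raw_fn Q"
  by (induction rule: alpha.induct)
    (simp_all, (drule raw_fn_diff_eqI[OF _ freshening_single freshening_single]
        raw_fn_diff_eqI[OF _ freshening_pair freshening_pair]; simp)+)

lemma alpha_rebind:
  assumes alpha: "alpha (rename f P) (rename f' P')"
    and fresh: "freshening f Y Z P" "freshening f' Y' Z P'"
  obtains \<pi> where "alpha P (rename (apply \<pi>) P')"
    "\<And>a. a \<in> raw_fn P' - Y' \<Longrightarrow> \<pi> \<langle>$\<rangle> a = a"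
    "\<And>a b. a \<in> Y' \<Longrightarrow> b \<in> Y \<Longrightarrow> f' a = f b \<Longrightarrow> \<pi> \<langle>$\<rangle> a = b"
proof -
  obtain \<rho> where \<rho>: "\<And>a. a \<in> Y \<union> names P \<Longrightarrow> \<rho> \<langle>$\<rangle> a = f a" "rename f P = rename (apply \<rho>) P"
    using freshening_permE[OF fresh(1)] by blast
  obtain \<rho>' where \<rho>': "\<And>a. a \<in> Y' \<union> names P' \<Longrightarrow> \<rho>' \<langle>$\<rangle> a = f' a"
      "rename f' P' = rename (apply \<rho>') P'"
    using freshening_permE[OF fresh(2)] by blast
  have inverse_\<rho>: "inverse \<rho> \<langle>$\<rangle> (\<rho> \<langle>$\<rangle> a) = a" for a
    by (simp add: apply_sequence)
  show thesis
  proof (rule that[of "inverse \<rho> * \<rho>'"])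
    have "alpha (rename (apply (inverse \<rho>)) (rename f P))
        (rename (apply (inverse \<rho>)) (rename f' P'))"
      using alpha inj_apply by (rule alpha_rename)
    then show "alpha P (rename (apply (inverse \<rho> * \<rho>')) P')"
      by (simp add: \<rho>(2) \<rho>'(2) raw_process.map_comp raw_process.map_id flip: apply_times)
  next
    fix a assume a: "a \<in> raw_fn P' - Y'"
    then have "a \<in> raw_fn P - Y"
      using raw_fn_diff_eqI[OF alpha_raw_fn[OF alpha] fresh] by simp
    then have "\<rho> \<langle>$\<rangle> a = a" "\<rho>' \<langle>$\<rangle> a = a"
      using a fresh raw_fn_subset_names[of P] raw_fn_subset_names[of P']
      by (auto simp: \<rho>(1) \<rho>'(1) freshening_def subset_iff)
    then show "(inverse \<rho> * \<rho>') \<langle>$\<rangle> a = a"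
      using inverse_\<rho>[of a] by (simp add: apply_times)
  next
    fix a b assume "a \<in> Y'" "b \<in> Y" "f' a = f b"
    then have "\<rho>' \<langle>$\<rangle> a = \<rho> \<langle>$\<rangle> b"
      by (simp add: \<rho>(1) \<rho>'(1))
    then show "(inverse \<rho> * \<rho>') \<langle>$\<rangle> a = b"
      by (simp add: apply_times inverse_\<rho>)
  qed
qed

section \<open>Free names, permutations and inversion on processes\<close>

lift_definition fn :: "process \<Rightarrow> name set" is raw_fn
  by (rule alpha_raw_fn)

lemma fn_simps [simp]:
  "fn (Out x y P) = insert x (fn P - {y})"
  "fn (Inp x y P) = insert x (fn P - {y})"
  "fn (Close x P) = insert x (fn P)"
  "fn (Wait x P) = insert x (fn P)"
  "fn (SelL x P) = insert x (fn P)"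
  "fn (SelR x P) = insert x (fn P)"
  "fn (Case x P Q) = insert x (fn P \<union> fn Q)"
  "fn (Server x y P) = insert x (fn P - {y})"
  "fn (Client x y P) = insert x (fn P - {y})"
  "fn (Dup x y1 y2 P) = insert x (fn P - {y1, y2})"
  "fn (Disp x P) = insert x (fn P)"
  "fn (Res y1 y2 P) = fn P - {y1, y2}"
  "fn (Par P Q) = fn P \<union> fn Q"
  "fn Nil0 = {}"
  "fn (Link x y) = {x, y}"
  by (transfer, simp)+

lift_definition permute :: "name perm \<Rightarrow> process \<Rightarrow> process" is "\<lambda>\<pi>. rename (apply \<pi>)"
  by (simp add: alpha_rename)

lemma permute_simps [simp]:
  "permute \<pi> (Out x y P) = Out (\<pi> \<langle>$\<rangle> x) (\<pi> \<langle>$\<rangle> y) (permute \<pi> P)"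
  "permute \<pi> (Inp x y P) = Inp (\<pi> \<langle>$\<rangle> x) (\<pi> \<langle>$\<rangle> y) (permute \<pi> P)"
  "permute \<pi> (Close x P) = Close (\<pi> \<langle>$\<rangle> x) (permute \<pi> P)"
  "permute \<pi> (Wait x P) = Wait (\<pi> \<langle>$\<rangle> x) (permute \<pi> P)"
  "permute \<pi> (SelL x P) = SelL (\<pi> \<langle>$\<rangle> x) (permute \<pi> P)"
  "permute \<pi> (SelR x P) = SelR (\<pi> \<langle>$\<rangle> x) (permute \<pi> P)"
  "permute \<pi> (Case x P Q) = Case (\<pi> \<langle>$\<rangle> x) (permute \<pi> P) (permute \<pi> Q)"
  "permute \<pi> (Server x y P) = Server (\<pi> \<langle>$\<rangle> x) (\<pi> \<langle>$\<rangle> y) (permute \<pi> P)"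
  "permute \<pi> (Client x y P) = Client (\<pi> \<langle>$\<rangle> x) (\<pi> \<langle>$\<rangle> y) (permute \<pi> P)"
  "permute \<pi> (Dup x y1 y2 P) = Dup (\<pi> \<langle>$\<rangle> x) (\<pi> \<langle>$\<rangle> y1) (\<pi> \<langle>$\<rangle> y2) (permute \<pi> P)"
  "permute \<pi> (Disp x P) = Disp (\<pi> \<langle>$\<rangle> x) (permute \<pi> P)"
  "permute \<pi> (Res y1 y2 P) = Res (\<pi> \<langle>$\<rangle> y1) (\<pi> \<langle>$\<rangle> y2) (permute \<pi> P)"
  "permute \<pi> (Par P Q) = Par (permute \<pi> P) (permute \<pi> Q)"
  "permute \<pi> Nil0 = Nil0"
  "permute \<pi> (Link x y) = Link (\<pi> \<langle>$\<rangle> x) (\<pi> \<langle>$\<rangle> y)"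
  by (transfer, unfold raw_process.map, rule alpha_refl)+

text \<open>Collapsing all names to a point makes distinctness of the constructors of
  \<^typ>\<open>process\<close> a consequence of distinctness for the datatype.\<close>

lift_definition skeleton :: "process \<Rightarrow> unit raw_process" is "rename (\<lambda>_. ())"
  by (erule alpha.induct) (simp_all add: raw_process.map_comp comp_def)

lemma skeleton_simps [simp]:
  "skeleton (Out x y P) = ROut () () (skeleton P)"
  "skeleton (Inp x y P) = RInp () () (skeleton P)"
  "skeleton (Close x P) = RClose () (skeleton P)"
  "skeleton (Wait x P) = RWait () (skeleton P)"
  "skeleton (SelL x P) = RSelL () (skeleton P)"
  "skeleton (SelR x P) = RSelR () (skeleton P)"
  "skeleton (Case x P Q) = RCase () (skeleton P) (skeleton Q)"
  "skeleton (Server x y P) = RServer () () (skeleton P)"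
  "skeleton (Client x y P) = RClient () () (skeleton P)"
  "skeleton (Dup x y1 y2 P) = RDup () () () (skeleton P)"
  "skeleton (Disp x P) = RDisp () (skeleton P)"
  "skeleton (Res y1 y2 P) = RRes () () (skeleton P)"
  "skeleton (Par P Q) = RPar (skeleton P) (skeleton Q)"
  "skeleton Nil0 = RNil"
  "skeleton (Link x y) = RLink () ()"
  by (transfer, simp)+

lemma nonbinding_inject:
  "Close x P = Close x' P' \<longleftrightarrow> x = x' \<and> P = P'"
  "Wait x P = Wait x' P' \<longleftrightarrow> x = x' \<and> P = P'"
  "SelL x P = SelL x' P' \<longleftrightarrow> x = x' \<and> P = P'"
  "SelR x P = SelR x' P' \<longleftrightarrow> x = x' \<and> P = P'"
  "Disp x P = Disp x' P' \<longleftrightarrow> x = x' \<and> P = P'"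
  "Par P Q = Par P' Q' \<longleftrightarrow> P = P' \<and> Q = Q'"
  by (transfer, auto elim!: alpha_elims(3-6,11,13) intro: alpha.intros(3-6,11,13))+

definition rebinds :: "name perm \<Rightarrow> name set \<Rightarrow> process \<Rightarrow> process \<Rightarrow> bool" where
  "rebinds \<pi> Y P' P \<longleftrightarrow> P = permute \<pi> P' \<and> (\<forall>a \<in> fn P' - Y. \<pi> \<langle>$\<rangle> a = a)"

lemma alpha_rebind_single:
  assumes "alpha (rename (id(y := z)) P) (rename (id(y' := z)) P')"
    and "z \<notin> names P" "z \<notin> names P'"
  shows "\<exists>\<pi>. (alpha P (rename (apply \<pi>) P') \<and> (\<forall>a \<in> raw_fn P' - {y'}. \<pi> \<langle>$\<rangle> a = a))
    \<and> \<pi> \<langle>$\<rangle> y' = y"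
  by (rule alpha_rebind[OF assms(1) freshening_single freshening_single]) (use assms(2,3) in auto)

lemma alpha_rebind_pair:
  assumes "alpha (rename (id(y1 := z1, y2 := z2)) P) (rename (id(y1' := z1, y2' := z2)) P')"
    and "z1 \<noteq> z2" "z1 \<notin> names P" "z1 \<notin> names P'" "z2 \<notin> names P" "z2 \<notin> names P'"
    and "y1 \<noteq> y2" "y1' \<noteq> y2'"
  shows "\<exists>\<pi>. (alpha P (rename (apply \<pi>) P') \<and> (\<forall>a \<in> raw_fn P' - {y1', y2'}. \<pi> \<langle>$\<rangle> a = a))
    \<and> \<pi> \<langle>$\<rangle> y1' = y1 \<and> \<pi> \<langle>$\<rangle> y2' = y2"
proof (rule alpha_rebind[OF assms(1) freshening_pair freshening_pair])
  fix \<pi>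
  assume rebind: "alpha P (rename (apply \<pi>) P')"
      "\<And>a. a \<in> raw_fn P' - {y1', y2'} \<Longrightarrow> \<pi> \<langle>$\<rangle> a = a"
    and bound: "\<And>a b. a \<in> {y1', y2'} \<Longrightarrow> b \<in> {y1, y2} \<Longrightarrow>
      (id(y1' := z1, y2' := z2)) a = (id(y1 := z1, y2 := z2)) b \<Longrightarrow> \<pi> \<langle>$\<rangle> a = b"
  have "\<pi> \<langle>$\<rangle> y1' = y1" "\<pi> \<langle>$\<rangle> y2' = y2"
    by (rule bound; use assms(7,8) in simp)+
  with rebind show ?thesis by blast
qed (use assms(2-6) in auto)

lemma
  shows Out_eqD: "Out x y P = Out x' y' P' \<Longrightarrow>
      x = x' \<and> (\<exists>\<pi>. rebinds \<pi> {y'} P' P \<and> \<pi> \<langle>$\<rangle> y' = y)"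
    and Inp_eqD: "Inp x y P = Inp x' y' P' \<Longrightarrow>
      x = x' \<and> (\<exists>\<pi>. rebinds \<pi> {y'} P' P \<and> \<pi> \<langle>$\<rangle> y' = y)"
    and Client_eqD: "Client x y P = Client x' y' P' \<Longrightarrow>
      x = x' \<and> (\<exists>\<pi>. rebinds \<pi> {y'} P' P \<and> \<pi> \<langle>$\<rangle> y' = y)"
  unfolding rebinds_def by (transfer, erule alpha_elims, drule (2) alpha_rebind_single, simp)+

lemma
  shows Dup_eqD: "Dup x y1 y2 P = Dup x' y1' y2' P' \<Longrightarrow> y1 \<noteq> y2 \<Longrightarrow> y1' \<noteq> y2' \<Longrightarrow>
      x = x' \<and> (\<exists>\<pi>. rebinds \<pi> {y1', y2'} P' P \<and> \<pi> \<langle>$\<rangle> y1' = y1 \<and> \<pi> \<langle>$\<rangle> y2' = y2)"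
    and Res_eqD: "Res y1 y2 P = Res y1' y2' P' \<Longrightarrow> y1 \<noteq> y2 \<Longrightarrow> y1' \<noteq> y2' \<Longrightarrow>
      \<exists>\<pi>. rebinds \<pi> {y1', y2'} P' P \<and> \<pi> \<langle>$\<rangle> y1' = y1 \<and> \<pi> \<langle>$\<rangle> y2' = y2"
  unfolding rebinds_def by (transfer, erule alpha_elims, drule (5) alpha_rebind_pair, simp_all)+

section \<open>Partition judgements\<close>

lemma distinct_names_permute:
  "distinct_names N \<Longrightarrow> distinct_names (image_mset (image_mset (apply \<pi>)) N)"
  by (simp add: distinct_names_iff inj_on_subset[OF inj_apply])

lemma partitioning_permute:
  "P \<tturnstile> N \<Longrightarrow> permute \<pi> P \<tturnstile> image_mset (image_mset (apply \<pi>)) N"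
  by (induction rule: partitioning.induct; (drule distinct_names_permute[of _ \<pi>])?;
    auto intro!: partitioning.intros[simplified])

lemma fn_partition: "P \<tturnstile> N \<Longrightarrow> fn P = set_mset (\<Sum>\<^sub># N)"
  by (induction rule: partitioning.induct)
    (auto dest!: partitioning_distinct_names simp: distinct_names_iff)

lemma Sum_mset_partition: "P \<tturnstile> N \<Longrightarrow> \<Sum>\<^sub># N = mset_set (fn P)"
  by (metis fn_partition mset_set_set_mset partitioning_distinct_names distinct_names_iff)

lemma rebinds_fixes:
  assumes "rebinds \<pi> Y P' P" "P' \<tturnstile> N" "\<Sum>\<^sub># N = M + \<Phi>" "Y \<subseteq> set_mset \<Phi>" "a \<in># M"
  shows "\<pi> \<langle>$\<rangle> a = a"
proof -
  have "distinct_mset (M + \<Phi>)"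
    using partitioning_distinct_names[OF assms(2)] assms(3) by (simp add: distinct_names_iff)
  then have "a \<notin> Y"
    using assms(4,5) by auto
  moreover have "a \<in> fn P'"
    using fn_partition[OF assms(2)] assms(3,5) by (metis UnCI set_mset_union)
  ultimately show ?thesis
    using assms(1) by (simp add: rebinds_def)
qed

lemma rebinds_partitioning_unary:
  assumes "rebinds \<pi> Y P' P" "P' \<tturnstile> G + {#\<Gamma> + \<Phi>#}" "Y \<subseteq> set_mset \<Phi>"
  shows "P \<tturnstile> G + {#\<Gamma> + image_mset (apply \<pi>) \<Phi>#}"
proof -
  have "\<pi> \<langle>$\<rangle> a = a" if "a \<in># \<Sum>\<^sub># G + \<Gamma>" for a
    by (rule rebinds_fixes[OF assms(1,2) _ assms(3) that]) (simp add: ac_simps)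
  then have "image_mset (image_mset (apply \<pi>)) G = G" "image_mset (apply \<pi>) \<Gamma> = \<Gamma>"
    by (auto intro!: multiset.map_ident_strong)
  then show ?thesis
    using partitioning_permute[OF assms(2), of \<pi>] assms(1) by (simp add: rebinds_def)
qed

lemma rebinds_partitioning_binary:
  assumes "rebinds \<pi> Y P' P" "P' \<tturnstile> G + {#\<Gamma> + \<Phi>, \<Delta> + \<Psi>#}" "Y \<subseteq> set_mset (\<Phi> + \<Psi>)"
  shows "P \<tturnstile> G + {#\<Gamma> + image_mset (apply \<pi>) \<Phi>, \<Delta> + image_mset (apply \<pi>) \<Psi>#}"
proof -
  have "\<pi> \<langle>$\<rangle> a = a" if "a \<in># \<Sum>\<^sub># G + \<Gamma> + \<Delta>" for a
    by (rule rebinds_fixes[OF assms(1,2) _ assms(3) that]) (simp add: ac_simps)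
  then have "image_mset (image_mset (apply \<pi>)) G = G"
      "image_mset (apply \<pi>) \<Gamma> = \<Gamma>" "image_mset (apply \<pi>) \<Delta> = \<Delta>"
    by (auto intro!: multiset.map_ident_strong)
  then show ?thesis
    using partitioning_permute[OF assms(2), of \<pi>] assms(1) by (simp add: rebinds_def)
qed

lemma partitioning_ResD:
  assumes "Res x y P \<tturnstile> N" "x \<noteq> y"
  shows "\<exists>G \<Gamma> \<Delta>. N = G + {#\<Gamma> + \<Delta>#} \<and> P \<tturnstile> G + {#\<Gamma> + {#x#}, \<Delta> + {#y#}#}"
  using assms(1)
proof (cases rule: partitioning.cases)
  case (P_Cut P' G \<Gamma> x' \<Delta> y')
  have "x' \<noteq> y'"
    using partitioning_distinct_names[OF P_Cut(3)] by (auto simp: distinct_names_iff)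
  then obtain \<pi> where "rebinds \<pi> {x', y'} P' P" "\<pi> \<langle>$\<rangle> x' = x" "\<pi> \<langle>$\<rangle> y' = y"
    using Res_eqD[OF P_Cut(1) assms(2)] by blast
  then have "P \<tturnstile> G + {#\<Gamma> + {#x#}, \<Delta> + {#y#}#}"
    using rebinds_partitioning_binary[OF _ P_Cut(3)] by fastforce
  with P_Cut(2) show ?thesis by blast
qed (auto dest: arg_cong[of _ _ skeleton])

lemma partitioning_OutD:
  assumes "Out x y P \<tturnstile> N"
  shows "\<exists>G \<Gamma> \<Delta>. N = G + {#\<Gamma> + \<Delta> + {#x#}#} \<and> P \<tturnstile> G + {#\<Gamma> + {#y#}, \<Delta> + {#x#}#}"
  using assms
proof (cases rule: partitioning.cases)
  case (P_Tensor P' G \<Gamma> y' \<Delta> x')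
  obtain \<pi> where "x = x'" "rebinds \<pi> {y'} P' P" "\<pi> \<langle>$\<rangle> y' = y"
    using Out_eqD[OF P_Tensor(1)] by blast
  moreover have "P' \<tturnstile> G + {#\<Gamma> + {#y'#}, \<Delta> + {#x'#} + {#}#}"
    using P_Tensor(3) by simp
  ultimately have "P \<tturnstile> G + {#\<Gamma> + {#y#}, \<Delta> + {#x#}#}"
    by (fastforce dest: rebinds_partitioning_binary)
  with P_Tensor(2) \<open>x = x'\<close> show ?thesis by blast
qed (auto dest: arg_cong[of _ _ skeleton])

lemma partitioning_InpD:
  assumes "Inp x y P \<tturnstile> N"
  shows "\<exists>G \<Gamma>. N = G + {#\<Gamma> + {#x#}#} \<and> P \<tturnstile> G + {#\<Gamma> + {#y, x#}#}"
  using assms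
proof (cases rule: partitioning.cases)
  case (P_Parr P' G \<Gamma> y' x')
  obtain \<pi> where "x = x'" "rebinds \<pi> {y'} P' P" "\<pi> \<langle>$\<rangle> y' = y"
    using Inp_eqD[OF P_Parr(1)] by blast
  moreover have "P' \<tturnstile> G + {#\<Gamma> + {#x'#} + {#y'#}#}"
    using P_Parr(3) by simp
  ultimately have "P \<tturnstile> G + {#\<Gamma> + {#y, x#}#}"
    by (fastforce dest: rebinds_partitioning_unary)
  with P_Parr(2) \<open>x = x'\<close> show ?thesis by blast
qed (auto dest: arg_cong[of _ _ skeleton])

lemma partitioning_ClientD:
  assumes "Client x y P \<tturnstile> N"
  shows "\<exists>G \<Gamma>. N = G + {#\<Gamma> + {#x#}#} \<and> P \<tturnstile> G + {#\<Gamma> + {#y#}#}"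
  using assms
proof (cases rule: partitioning.cases)
  case (P_WhyNot P' G \<Gamma> y' x')
  obtain \<pi> where "x = x'" "rebinds \<pi> {y'} P' P" "\<pi> \<langle>$\<rangle> y' = y"
    using Client_eqD[OF P_WhyNot(1)] by blast
  then have "P \<tturnstile> G + {#\<Gamma> + {#y#}#}"
    using rebinds_partitioning_unary[OF _ P_WhyNot(3)] by fastforce
  with P_WhyNot(2) \<open>x = x'\<close> show ?thesis by blast
qed (auto dest: arg_cong[of _ _ skeleton])

lemma partitioning_DupD:
  assumes "Dup x x1 x2 P \<tturnstile> N" "x1 \<noteq> x2"
  shows "\<exists>G \<Gamma>. N = G + {#\<Gamma> + {#x#}#} \<and> P \<tturnstile> G + {#\<Gamma> + {#x1, x2#}#}"
  using assms(1)
proof (cases rule: partitioning.cases)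
  case (P_Contract P' G \<Gamma> x1' x2' x')
  have "x1' \<noteq> x2'"
    using partitioning_distinct_names[OF P_Contract(3)] by (auto simp: distinct_names_iff)
  then obtain \<pi> where "x = x'" "rebinds \<pi> {x1', x2'} P' P" "\<pi> \<langle>$\<rangle> x1' = x1" "\<pi> \<langle>$\<rangle> x2' = x2"
    using Dup_eqD[OF P_Contract(1) assms(2)] by blast
  then have "P \<tturnstile> G + {#\<Gamma> + {#x1, x2#}#}"
    using rebinds_partitioning_unary[OF _ P_Contract(3)] by fastforce
  with P_Contract(2) \<open>x = x'\<close> show ?thesis by blast
qed (auto dest: arg_cong[of _ _ skeleton])

lemma
  shows partitioning_ParD: "Par P Q \<tturnstile> N \<Longrightarrow> \<exists>G H. N = G + H \<and> P \<tturnstile> G \<and> Q \<tturnstile> H"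
    and partitioning_Nil0D: "Nil0 \<tturnstile> N \<Longrightarrow> N = {#}"
    and partitioning_CloseD: "Close x P \<tturnstile> N \<Longrightarrow> \<exists>G. N = G + {#{#x#}#} \<and> P \<tturnstile> G"
    and partitioning_WaitD: "Wait x P \<tturnstile> N \<Longrightarrow>
      \<exists>G \<Gamma>. N = G + {#\<Gamma> + {#x#}#} \<and> P \<tturnstile> G + {#\<Gamma>#}"
    and partitioning_SelLD: "SelL x P \<tturnstile> N \<Longrightarrow>
      \<exists>G \<Gamma>. N = G + {#\<Gamma> + {#x#}#} \<and> P \<tturnstile> G + {#\<Gamma> + {#x#}#}"
    and partitioning_SelRD: "SelR x P \<tturnstile> N \<Longrightarrow>
      \<exists>G \<Gamma>. N = G + {#\<Gamma> + {#x#}#} \<and> P \<tturnstile> G + {#\<Gamma> + {#x#}#}"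
    and partitioning_DispD: "Disp x P \<tturnstile> N \<Longrightarrow>
      \<exists>G \<Gamma>. N = G + {#\<Gamma> + {#x#}#} \<and> P \<tturnstile> G + {#\<Gamma>#}"
  by (erule partitioning.cases;
    (drule arg_cong[of _ _ skeleton], simp; fail | simp only: nonbinding_inject, blast))+

lemma
  shows partitioning_Link_singleton: "Link x y \<tturnstile> N \<Longrightarrow> \<exists>\<Gamma>. N = {#\<Gamma>#}"
    and partitioning_Case_singleton: "Case x P Q \<tturnstile> N \<Longrightarrow> \<exists>\<Gamma>. N = {#\<Gamma>#}"
    and partitioning_Server_singleton: "Server x y P \<tturnstile> N \<Longrightarrow> \<exists>\<Gamma>. N = {#\<Gamma>#}"
  by (erule partitioning.cases; auto dest: arg_cong[of _ _ skeleton])+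

section \<open>Retyping along a partition\<close>

lemma strip_simps [simp]:
  "strip {#} = {#}"
  "strip (\<G> + \<H>) = strip \<G> + strip \<H>"
  "strip (add_mset \<Gamma> \<G>) = add_mset (image_mset fst \<Gamma>) (strip \<G>)"
  by (simp_all add: strip_def)

lemma Sum_strip [simp]: "\<Sum>\<^sub># (strip \<G>) = image_mset fst (\<Sum>\<^sub># \<G>)"
  by (simp add: strip_def)

lemma hyperenv_iff:
  "hyperenv \<G> \<longleftrightarrow> distinct_mset (\<Sum>\<^sub># \<G>) \<and> inj_on fst (set_mset (\<Sum>\<^sub># \<G>))"
  by (simp add: hyperenv_def distinct_names_iff)

lemma typing_partitioning: "\<turnstile> P \<Colon> \<G> \<Longrightarrow> P \<tturnstile> strip \<G>"
  by (induction rule: typing.induct)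
    (auto simp: hyperenv_def intro!: partitioning.intros[simplified])

lemma partitioning_hyperenv: "P \<tturnstile> strip \<G> \<Longrightarrow> hyperenv \<G>"
  by (simp add: hyperenv_def partitioning_distinct_names)

lemma strip_eq_plusE:
  assumes "strip \<G> = M + N"
  obtains \<G>1 \<G>2 where "\<G> = \<G>1 + \<G>2" "strip \<G>1 = M" "strip \<G>2 = N"
  using image_mset_eq_plusD[OF assms[unfolded strip_def]] by (auto simp: strip_def)

lemma strip_eq_add_envE:
  assumes "strip \<G> = M + {#N#}"
  obtains \<H> \<Gamma> where "\<G> = \<H> + {#\<Gamma>#}" "strip \<H> = M" "image_mset fst \<Gamma> = N"
  using assms msed_map_invR[of "image_mset fst" \<G> N M] by (auto simp: strip_def)

lemma hyperenv_submset_eqI: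
  assumes "hyperenv \<G>" "\<Phi> \<subseteq># \<Sum>\<^sub># \<G>" "\<Psi> \<subseteq># \<Sum>\<^sub># \<G>" "image_mset fst \<Phi> = image_mset fst \<Psi>"
  shows "\<Phi> = \<Psi>"
  using assms(4)
proof (rule multiset.inj_map_strong[rotated])
  fix p q assume "p \<in># \<Phi>" "q \<in># \<Psi>" "fst p = fst q"
  then show "p = q"
    using assms(1-3) by (auto simp: hyperenv_iff dest!: mset_subset_eqD dest: inj_onD)
qed

lemma strip_eq_principalE:
  assumes "hyperenv \<G>" "strip \<G> = M + {#N + image_mset fst \<Phi>#}" "\<Phi> \<subseteq># \<Sum>\<^sub># \<G>"
  obtains \<H> \<Gamma> where "\<G> = \<H> + {#\<Gamma> + \<Phi>#}" "strip \<H> = M" "image_mset fst \<Gamma> = N"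
proof -
  obtain \<H> \<Gamma>' where \<G>: "\<G> = \<H> + {#\<Gamma>'#}" "strip \<H> = M"
    and "image_mset fst \<Gamma>' = N + image_mset fst \<Phi>"
    using assms(2) by (rule strip_eq_add_envE)
  then obtain \<Gamma> \<Psi> where \<Gamma>': "\<Gamma>' = \<Gamma> + \<Psi>" "image_mset fst \<Gamma> = N"
      "image_mset fst \<Psi> = image_mset fst \<Phi>"
    using image_mset_eq_plusD by metis
  have "\<Psi> = \<Phi>"
    using assms(1) _ assms(3) \<Gamma>'(3) by (rule hyperenv_submset_eqI) (simp add: \<G>(1) \<Gamma>'(1))
  with \<G> \<Gamma>' show thesis using that by blast
qed

definition retypable :: "process \<Rightarrow> henv \<Rightarrow> bool" where
  "retypable P \<G> \<longleftrightarrow> (\<forall>\<G>'. P \<tturnstile> strip \<G>' \<longrightarrow> \<Sum>\<^sub># \<G>' = \<Sum>\<^sub># \<G> \<longrightarrow> \<turnstile> P \<Colon> \<G>')"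

lemma retypableI:
  assumes "\<And>\<G>'. hyperenv \<G>' \<Longrightarrow> P \<tturnstile> strip \<G>' \<Longrightarrow> \<Sum>\<^sub># \<G>' = \<Sum>\<^sub># \<G> \<Longrightarrow> \<turnstile> P \<Colon> \<G>'"
  shows "retypable P \<G>"
  using assms partitioning_hyperenv unfolding retypable_def by blast

lemma retypableD:
  "retypable P \<G> \<Longrightarrow> P \<tturnstile> strip \<G>' \<Longrightarrow> \<Sum>\<^sub># \<G>' = \<Sum>\<^sub># \<G> \<Longrightarrow> \<turnstile> P \<Colon> \<G>'"
  unfolding retypable_def by blast

lemma retypable_singleton:
  assumes "\<turnstile> P \<Colon> {#\<Gamma>#}" "\<And>N. P \<tturnstile> N \<Longrightarrow> \<exists>\<Delta>. N = {#\<Delta>#}"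
  shows "retypable P {#\<Gamma>#}"
proof (rule retypableI)
  fix \<G>' assume \<G>': "P \<tturnstile> strip \<G>'" "\<Sum>\<^sub># \<G>' = \<Sum>\<^sub># {#\<Gamma>#}"
  then obtain \<Delta> where "strip \<G>' = {#} + {#\<Delta>#}"
    using assms(2) by fastforce
  then obtain \<Gamma>' where "\<G>' = {#\<Gamma>'#}"
    by (rule strip_eq_add_envE) (simp add: strip_def)
  with \<G>'(2) assms(1) show "\<turnstile> P \<Colon> \<G>'" by simp
qed

lemma retypable_unary:
  assumes premise: "retypable P (\<G> + {#\<Gamma> + \<Phi>#})"
    and partition: "\<And>N. Q \<tturnstile> N \<Longrightarrow>
      \<exists>M \<Gamma>. N = M + {#\<Gamma> + image_mset fst \<Psi>#} \<and> P \<tturnstile> M + {#\<Gamma> + image_mset fst \<Phi>#}"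
    and typing_rule: "\<And>\<G> \<Gamma>. \<turnstile> P \<Colon> \<G> + {#\<Gamma> + \<Phi>#} \<Longrightarrow> hyperenv (\<G> + {#\<Gamma> + \<Psi>#}) \<Longrightarrow>
      \<turnstile> Q \<Colon> \<G> + {#\<Gamma> + \<Psi>#}"
  shows "retypable Q (\<G> + {#\<Gamma> + \<Psi>#})"
proof (rule retypableI)
  fix \<G>' assume \<G>': "hyperenv \<G>'" "Q \<tturnstile> strip \<G>'" "\<Sum>\<^sub># \<G>' = \<Sum>\<^sub># (\<G> + {#\<Gamma> + \<Psi>#})"
  obtain M N where strip_\<G>': "strip \<G>' = M + {#N + image_mset fst \<Psi>#}"
    and P: "P \<tturnstile> M + {#N + image_mset fst \<Phi>#}"
    using partition[OF \<G>'(2)] by blast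
  have "\<Psi> \<subseteq># \<Sum>\<^sub># \<G>'"
    by (simp add: \<G>'(3))
  with \<G>'(1) strip_\<G>' obtain \<H> \<Delta> where \<H>: "\<G>' = \<H> + {#\<Delta> + \<Psi>#}" "strip \<H> = M" "image_mset fst \<Delta> = N"
    by (rule strip_eq_principalE)
  have "\<turnstile> P \<Colon> \<H> + {#\<Delta> + \<Phi>#}"
    using P \<G>'(3) by (intro retypableD[OF premise]) (simp_all add: \<H> ac_simps)
  then show "\<turnstile> Q \<Colon> \<G>'"
    using \<G>'(1) unfolding \<H>(1) by (rule typing_rule)
qed

lemma retypable_binary:
  assumes premise: "retypable P (\<G> + {#\<Gamma> + \<Phi>1, \<Delta> + \<Phi>2#})"
    and partition: "\<And>N. Q \<tturnstile> N \<Longrightarrow> \<exists>M \<Gamma> \<Delta>. N = M + {#\<Gamma> + \<Delta> + image_mset fst \<Psi>#} \<and>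
      P \<tturnstile> M + {#\<Gamma> + image_mset fst \<Phi>1, \<Delta> + image_mset fst \<Phi>2#}"
    and typing_rule: "\<And>\<G> \<Gamma> \<Delta>. \<turnstile> P \<Colon> \<G> + {#\<Gamma> + \<Phi>1, \<Delta> + \<Phi>2#} \<Longrightarrow> \<turnstile> Q \<Colon> \<G> + {#\<Gamma> + \<Delta> + \<Psi>#}"
  shows "retypable Q (\<G> + {#\<Gamma> + \<Delta> + \<Psi>#})"
proof (rule retypableI)
  fix \<G>' assume \<G>': "hyperenv \<G>'" "Q \<tturnstile> strip \<G>'" "\<Sum>\<^sub># \<G>' = \<Sum>\<^sub># (\<G> + {#\<Gamma> + \<Delta> + \<Psi>#})"
  obtain M N1 N2 where strip_\<G>': "strip \<G>' = M + {#N1 + N2 + image_mset fst \<Psi>#}"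
    and P: "P \<tturnstile> M + {#N1 + image_mset fst \<Phi>1, N2 + image_mset fst \<Phi>2#}"
    using partition[OF \<G>'(2)] by blast
  have "\<Psi> \<subseteq># \<Sum>\<^sub># \<G>'"
    by (simp add: \<G>'(3))
  with \<G>'(1) strip_\<G>' obtain \<H> \<Xi> where \<H>: "\<G>' = \<H> + {#\<Xi> + \<Psi>#}" "strip \<H> = M"
    and "image_mset fst \<Xi> = N1 + N2"
    by (rule strip_eq_principalE)
  then obtain \<Xi>1 \<Xi>2 where \<Xi>: "\<Xi> = \<Xi>1 + \<Xi>2" "image_mset fst \<Xi>1 = N1" "image_mset fst \<Xi>2 = N2"
    using image_mset_eq_plusD by metis
  have "\<turnstile> P \<Colon> \<H> + {#\<Xi>1 + \<Phi>1, \<Xi>2 + \<Phi>2#}"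
    using P \<G>'(3) by (intro retypableD[OF premise]) (simp_all add: \<H> \<Xi> ac_simps)
  then show "\<turnstile> Q \<Colon> \<G>'"
    unfolding \<H>(1) \<Xi>(1) by (rule typing_rule)
qed

lemma retypable_Close:
  assumes "retypable P \<G>"
  shows "retypable (Close x P) (\<G> + {#{#(x, One)#}#})"
proof (rule retypableI)
  fix \<G>' assume \<G>': "hyperenv \<G>'" "Close x P \<tturnstile> strip \<G>'" "\<Sum>\<^sub># \<G>' = \<Sum>\<^sub># (\<G> + {#{#(x, One)#}#})"
  obtain M where strip_\<G>': "strip \<G>' = M + {#{#} + image_mset fst {#(x, One)#}#}" and P: "P \<tturnstile> M"
    using partitioning_CloseD[OF \<G>'(2)] by auto
  have "{#(x, One)#} \<subseteq># \<Sum>\<^sub># \<G>'"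
    by (simp add: \<G>'(3))
  with \<G>'(1) strip_\<G>' obtain \<H> \<Gamma> where \<H>: "\<G>' = \<H> + {#\<Gamma> + {#(x, One)#}#}" "strip \<H> = M" "\<Gamma> = {#}"
    by (rule strip_eq_principalE) simp
  have "\<turnstile> P \<Colon> \<H>"
    using P \<G>'(3) by (intro retypableD[OF assms]) (simp_all add: \<H>)
  with \<G>'(1) show "\<turnstile> Close x P \<Colon> \<G>'"
    unfolding \<H>(1,3) by (simp add: T_One[simplified])
qed

lemma retypable_Par:
  assumes typing: "\<turnstile> P \<Colon> \<G>" "\<turnstile> Q \<Colon> \<H>" and retypable: "retypable P \<G>" "retypable Q \<H>"
  shows "retypable (Par P Q) (\<G> + \<H>)"
proof (rule retypableI)
  fix \<G>' assume \<G>': "hyperenv \<G>'" "Par P Q \<tturnstile> strip \<G>'" "\<Sum>\<^sub># \<G>' = \<Sum>\<^sub># (\<G> + \<H>)"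
  obtain M N where partitions: "strip \<G>' = M + N" "P \<tturnstile> M" "Q \<tturnstile> N"
    using partitioning_ParD[OF \<G>'(2)] by blast
  obtain \<G>1 \<H>1 where split: "\<G>' = \<G>1 + \<H>1" "strip \<G>1 = M" "strip \<H>1 = N"
    using partitions(1) by (rule strip_eq_plusE)
  have "\<Sum>\<^sub># \<G>1 \<subseteq># \<Sum>\<^sub># \<G>'" "\<Sum>\<^sub># \<G> \<subseteq># \<Sum>\<^sub># \<G>'"
    by (simp add: split(1), simp add: \<G>'(3))
  moreover have "image_mset fst (\<Sum>\<^sub># \<G>1) = image_mset fst (\<Sum>\<^sub># \<G>)"
    using Sum_mset_partition[OF typing_partitioning[OF typing(1)]] Sum_mset_partition[OF partitions(2)]
    by (simp flip: split(2))
  ultimately have Sum_eq: "\<Sum>\<^sub># \<G>1 = \<Sum>\<^sub># \<G>"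
    by (rule hyperenv_submset_eqI[OF \<G>'(1)])
  then have "\<Sum>\<^sub># \<H>1 = \<Sum>\<^sub># \<H>"
    using \<G>'(3) by (simp add: split(1))
  with Sum_eq have "\<turnstile> P \<Colon> \<G>1" "\<turnstile> Q \<Colon> \<H>1"
    using retypable[THEN retypableD] partitions(2,3) split(2,3) by blast+
  then show "\<turnstile> Par P Q \<Colon> \<G>'"
    using \<G>'(1) unfolding split(1) by (rule T_Mix)
qed

lemma typing_retypable: "\<turnstile> P \<Colon> \<G> \<Longrightarrow> retypable P \<G>"
proof (induction rule: typing.induct)
  case (T_Ax x A y)
  then show ?case
    by (intro retypable_singleton partitioning_Link_singleton typing.T_Ax)
next
  case (T_Cut P \<G> \<Gamma> x A \<Delta> y)
  have "x \<noteq> y"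
    using typing_hyperenv[OF T_Cut.hyps] by (auto simp: hyperenv_def distinct_names_iff)
  then show ?case
    using retypable_binary[OF T_Cut.IH, where \<Psi> = "{#}"] partitioning_ResD typing.T_Cut by simp
next
  case (T_Mix P \<G> Q \<H>)
  then show ?case by (intro retypable_Par)
next
  case T_Mix0
  show ?case
    by (rule retypableI, drule partitioning_Nil0D) (simp add: strip_def typing.T_Mix0)
next
  case (T_Tensor P \<G> \<Gamma> y A \<Delta> x B)
  from T_Tensor.IH show ?case
    by (rule retypable_binary) (use partitioning_OutD typing.T_Tensor in simp_all)
next
  case (T_One P \<G> x)
  then show ?case by (intro retypable_Close)
next
  case (T_Bot P \<G> \<Gamma> x)
  from T_Bot.IH have "retypable P (\<G> + {#\<Gamma> + {#}#})" by simp
  then show ?case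
    by (rule retypable_unary) (use partitioning_WaitD typing.T_Bot in simp_all)
next
  case (T_With P \<Gamma> x A Q B)
  from T_With.hyps show ?case
    by (intro retypable_singleton partitioning_Case_singleton typing.T_With)
next
  case (T_OfCourse P \<Gamma> y A x)
  from T_OfCourse.hyps show ?case
    by (intro retypable_singleton partitioning_Server_singleton typing.T_OfCourse)
next
  case (T_Weaken P \<G> \<Gamma> x A)
  from T_Weaken.IH have "retypable P (\<G> + {#\<Gamma> + {#}#})" by simp
  then show ?case
    by (rule retypable_unary) (use partitioning_DispD typing.T_Weaken in simp_all)
next
  case (T_Contract P \<G> \<Gamma> x1 A x2 x)
  have "x1 \<noteq> x2"
    using typing_hyperenv[OF T_Contract.hyps(1)] by (auto simp: hyperenv_def distinct_names_iff)
  show ?case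
    by (rule retypable_unary[OF T_Contract.IH])
      (use \<open>x1 \<noteq> x2\<close> partitioning_DupD typing.T_Contract in simp_all)
qed ((rule retypable_unary, assumption);
  use partitioning_InpD typing.T_Parr partitioning_SelLD typing.T_Plus1 partitioning_SelRD
    typing.T_Plus2 partitioning_ClientD typing.T_WhyNot in simp)+

lemma hyperenv_Sum_eqI:
  assumes "hyperenv \<G>" "hyperenv \<G>'" "set_mset (\<Sum>\<^sub># \<G>) = set_mset (\<Sum>\<^sub># \<G>')"
  shows "\<Sum>\<^sub># \<G> = \<Sum>\<^sub># \<G>'"
  using assms mset_set_set_mset by (metis hyperenv_iff)

theorem theorem2p4:
  fixes P :: process and \<G> \<G>' :: henv
  assumes "hyperenv \<G>" and "hyperenv \<G>'"
    and "\<turnstile> P \<Colon> \<G>"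
    and "P \<tturnstile> strip \<G>'"
    and "shuffling \<G> \<G>'"
  shows "\<turnstile> P \<Colon> \<G>'"
proof -
  have "set_mset (\<Sum>\<^sub># \<G>') = set_mset (\<Sum>\<^sub># \<G>)"
    using assms(5) by (auto simp: shuffling_def)
  with assms(2,1) have "\<Sum>\<^sub># \<G>' = \<Sum>\<^sub># \<G>"
    by (rule hyperenv_Sum_eqI)
  with typing_retypable[OF assms(3)] assms(4) show ?thesis
    by (rule retypableD)
qed

end
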